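(* For every $n\in\mathbb{Q}_{>0}$ and every integer $N\ge3$, $$\sum_{\substack{j+k=N\\ j\ge1,\,k\ge2}}2^k\,\zeta^\mu(j,k;n,2n)=\mu(N-1)\,\zeta^\mu(N;n)+2\,\mathcal{D}^\mu(N-1,1;n,\mu;n,2n).$$
   Context: Fix $\mu\in\mathbb{C}$ with $\mathrm{Re}(\mu)>0$. For $k_1,\dots,k_r\in\mathbb{N}$ with $k_r\ge2$ and $m_1,\dots,m_r\in\mathbb{Q}_{>0}$, $\zeta^\mu(k_1,\dots,k_r;m_1,\dots,m_r)=\sum_{0\le n_1\le\cdots\le n_r}\frac{\mu^r}{(n_1\mu+m_1)^{k_1}\cdots(n_r\mu+m_r)^{k_r}}$. For $K\in\mathbb{N}$ and parameters $a,b,c$ with positive real part, $\mathcal{D}^\mu(K,1;a,b;a,c)=(c-b)\sum_{0\le q_1\le q_2}\frac{\mu^2}{(q_1\mu+a)^{K}(q_2\mu+b)(q_2\mu+c)}$; here it is used with $(a,b,c)=(n,\mu,2n)$, i.e. $\mathcal{D}^\mu(N-1,1;n,\mu;n,2n)=(2n-\mu)\sum_{0\le q_1\le q_2}\frac{\mu^2}{(q_1\mu+n)^{N-1}(q_2\mu+\mu)(q_2\mu+2n)}$. *)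

theory Defs
  imports "HOL-Analysis.Analysis"
begin

text \<open>
  The series are unordered sums over the weakly increasing index tuples; the tuple
  \<open>n\<^sub>1 \<le> \<dots> \<le> n\<^sub>r\<close> is the sorted list \<open>ns\<close>, with \<open>r = length ks\<close>. Under the standing
  assumptions \<open>Re \<mu> > 0\<close>, \<open>k\<^sub>i \<ge> 1\<close>, \<open>k\<^sub>r \<ge> 2\<close>, \<open>m\<^sub>i > 0\<close> (respectively parameters with positive
  real part and \<open>K \<ge> 1\<close>) no denominator vanishes and the series converge absolutely.
\<close>

definition zeta_mu :: "complex \<Rightarrow> nat list \<Rightarrow> rat list \<Rightarrow> complex" where
  "zeta_mu \<mu> ks ms =
     (\<Sum>\<^sub>\<infinity>ns\<in>{ns :: nat list. length ns = length ks \<and> sorted ns}.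
        \<mu> ^ length ks /
        (\<Prod>i<length ks. (of_nat (ns ! i) * \<mu> + of_rat (ms ! i)) ^ (ks ! i)))"

text \<open>\<open>D_mu \<mu> K a b c\<close> is \<open>\<D>\<^sup>\<mu>(K, 1; a, b; a, c)\<close>.\<close>

definition D_mu :: "complex \<Rightarrow> nat \<Rightarrow> complex \<Rightarrow> complex \<Rightarrow> complex \<Rightarrow> complex" where
  "D_mu \<mu> K a b c =
     (c - b) * (\<Sum>\<^sub>\<infinity>(q1, q2)\<in>{(q1 :: nat, q2 :: nat). q1 \<le> q2}.
        \<mu>\<^sup>2 / ((of_nat q1 * \<mu> + a) ^ K * (of_nat q2 * \<mu> + b) * (of_nat q2 * \<mu> + c)))"

end

theory Submission imports Defs begin

text \<open>
  Put \<open>X\<^sub>p = p \<mu> + n\<close>. Writing the outer index as \<open>p + r\<close>, the denominator \<open>(p + r) \<mu> + 2 n\<close> is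
  \<open>X\<^sub>p + X\<^sub>r\<close>, so the left-hand side is a sum over all pairs \<open>(p, r)\<close> of a finite geometric sum.
  The diagonal \<open>p = r\<close> contributes \<open>N - 2\<close> copies of \<open>\<mu> \<zeta>(N; n)\<close>. Off the diagonal the geometric
  sum equals \<open>4 / ((X\<^sub>p + X\<^sub>r) (X\<^sub>r - X\<^sub>p) X\<^sub>p ^ (N - 2))\<close> up to a term antisymmetric in \<open>(p, r)\<close>,
  which sums to \<open>0\<close>. Partial fractions in \<open>r\<close> and a telescoping of harmonic numbers then give
  the remaining \<open>\<mu> \<zeta>(N; n)\<close> and the two copies of \<open>\<D>\<close>.
\<close>

section \<open>Real majorants for double series\<close>

lemma summable_on_Suc_powr:
  assumes "s < -1"
  shows "(\<lambda>p::nat. real (Suc p) powr s) summable_on UNIV"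
proof -
  have "summable (\<lambda>p. real (Suc p) powr s)"
    using assms summable_real_powr_iff[of s] summable_Suc_iff[of "\<lambda>p. real p powr s"] by simp
  thus ?thesis by (subst summable_on_UNIV_nonneg_real_iff) auto
qed

lemma summable_on_Suc_powr_Times:
  assumes "s < -1"
  shows "(\<lambda>(p::nat, r::nat). real (Suc p) powr s * real (Suc r) powr s) summable_on UNIV"
proof -
  let ?w = "\<lambda>p::nat. real (Suc p) powr s"
  have w: "?w summable_on UNIV" by (rule summable_on_Suc_powr[OF assms])
  have "(\<lambda>(p, r). ?w p * ?w r) summable_on (SIGMA p:UNIV. UNIV)"
  proof (rule summable_on_SigmaI)
    show "((\<lambda>r. case (p, r) of (p, r) \<Rightarrow> ?w p * ?w r) has_sum ?w p * infsum ?w UNIV) UNIV" for p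
      using has_sum_cmult_right[OF has_sum_infsum[OF w], of "?w p"] by simp
    show "(\<lambda>p. ?w p * infsum ?w UNIV) summable_on UNIV"
      by (rule summable_on_cmult_left[OF w])
  qed auto
  thus ?thesis by simp
qed

text \<open>Since \<open>s\<close> dominates the geometric mean of \<open>u\<close> and
  \<open>v\<close>, it can lend half a power to each; the resulting exponent 3/2 exceeds 1, which
  makes the product majorant summable.\<close>

lemma inverse_triple_product_le_powr:
  fixes u v s :: real
  assumes "0 < u" "0 < v" "u \<le> s" "v \<le> s"
  shows "1 / (u * v * s) \<le> u powr (-3/2) * v powr (-3/2)"
proof -
  have "sqrt u * sqrt v \<le> sqrt s * sqrt s"
    using assms by (intro mult_mono) auto
  hence sq: "sqrt u * sqrt v \<le> s" using assms by simp
  have pw: "x powr (-3/2) = 1 / (x * sqrt x)" if "x > 0" for x :: real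
  proof -
    have "x powr (-3/2) = x powr (-1) * x powr (-(1/2))"
      by (subst powr_add[symmetric]) simp
    thus ?thesis using that by (simp add: powr_minus powr_half_sqrt field_simps)
  qed
  have "1 / (u * v * s) \<le> 1 / (u * v * (sqrt u * sqrt v))"
    using assms sq by (intro divide_left_mono mult_left_mono) (auto intro!: mult_pos_pos)
  also have "\<dots> = u powr (-3/2) * v powr (-3/2)"
    using pw[OF assms(1)] pw[OF assms(2)] by simp
  finally show ?thesis .
qed

text \<open>One factor \<open>Suc (p + r)\<close> is lowered to \<open>Suc r\<close>, the other
  plays the role of \<open>s\<close> in the preceding bound.\<close>

lemma summable_on_inverse_Suc_add_square:
  "(\<lambda>(p::nat, r::nat). 1 / (real (Suc p) * real (Suc (p + r)) ^ 2)) summable_on UNIV"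
proof (rule summable_on_comparison_test[OF summable_on_Suc_powr_Times[of "-3/2"]])
  fix z :: "nat \<times> nat"
  obtain p r where z: "z = (p, r)" by (cases z)
  have "1 / (real (Suc p) * real (Suc (p + r)) ^ 2)
      \<le> 1 / (real (Suc p) * real (Suc r) * real (Suc (p + r)))"
    unfolding power2_eq_square mult.assoc
    by (intro divide_left_mono mult_left_mono mult_right_mono) (auto intro!: mult_pos_pos)
  also have "\<dots> \<le> real (Suc p) powr (-3/2) * real (Suc r) powr (-3/2)"
    by (rule inverse_triple_product_le_powr) auto
  finally show "(case z of (p, r) \<Rightarrow> 1 / (real (Suc p) * real (Suc (p + r)) ^ 2))
      \<le> (case z of (p, r) \<Rightarrow> real (Suc p) powr (-3/2) * real (Suc r) powr (-3/2))"
    by (simp add: z)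
qed auto

text \<open>On either side of the diagonal, let \<open>m\<close> be the smaller index and
  \<open>Suc d\<close> the gap. The denominator is then at least the product of
  \<open>Suc m\<close>, \<open>Suc d\<close> and a factor dominating both.\<close>

lemma summable_on_inverse_Suc_add_diff:
  "(\<lambda>(p::nat, r::nat). 1 / (real (Suc p) * real (Suc (p + r)) * \<bar>real r - real p\<bar>))
     summable_on {(p, r). p \<noteq> r}"
proof -
  let ?f = "\<lambda>(p::nat, r::nat). 1 / (real (Suc p) * real (Suc (p + r)) * \<bar>real r - real p\<bar>)"
  let ?w = "\<lambda>(p::nat, r::nat). real (Suc p) powr (-3/2) * real (Suc r) powr (-3/2)"
  have w: "?w summable_on UNIV" by (rule summable_on_Suc_powr_Times) simp
  have up: "(\<lambda>(m, d). ?f (m, m + Suc d)) summable_on UNIV"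
  proof (rule summable_on_comparison_test[OF w])
    fix z :: "nat \<times> nat"
    obtain m d where z: "z = (m, d)" by (cases z)
    have "?f (m, m + Suc d) = 1 / (real (Suc m) * real (Suc d) * real (Suc (m + (m + Suc d))))"
      by (simp add: field_simps)
    also have "\<dots> \<le> real (Suc m) powr (-3/2) * real (Suc d) powr (-3/2)"
      by (rule inverse_triple_product_le_powr) auto
    finally show "(case z of (m, d) \<Rightarrow> ?f (m, m + Suc d)) \<le> ?w z" by (simp add: z)
  qed auto
  have down: "(\<lambda>(m, d). ?f (m + Suc d, m)) summable_on UNIV"
  proof (rule summable_on_comparison_test[OF w])
    fix z :: "nat \<times> nat"
    obtain m d where z: "z = (m, d)" by (cases z)
    have "?f (m + Suc d, m)
        = 1 / (real (Suc (m + Suc d)) * (real (Suc d) * real (Suc (m + (m + Suc d)))))"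
      by (simp add: field_simps)
    also have "\<dots> \<le> 1 / (real (Suc m) * (real (Suc d) * real (Suc (m + (m + Suc d)))))"
      by (intro divide_left_mono mult_right_mono) (auto intro!: mult_pos_pos)
    also have "\<dots> \<le> real (Suc m) powr (-3/2) * real (Suc d) powr (-3/2)"
      unfolding mult.assoc[symmetric] by (rule inverse_triple_product_le_powr) auto
    finally show "(case z of (m, d) \<Rightarrow> ?f (m + Suc d, m)) \<le> ?w z" by (simp add: z)
  qed auto
  have bij_up: "bij_betw (\<lambda>(m, d). (m, m + Suc d)) UNIV {(p::nat, r). p < r}"
    by (rule bij_betwI[where g = "\<lambda>(p, r). (p, r - Suc p)"]) auto
  have bij_down: "bij_betw (\<lambda>(m, d). (m + Suc d, m)) UNIV {(p::nat, r). r < p}"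
    by (rule bij_betwI[where g = "\<lambda>(p, r). (r, p - Suc r)"]) auto
  have "?f summable_on {(p, r). p < r}"
    using up summable_on_reindex_bij_betw[OF bij_up, of ?f] by (simp add: case_prod_unfold)
  moreover have "?f summable_on {(p, r). r < p}"
    using down summable_on_reindex_bij_betw[OF bij_down, of ?f] by (simp add: case_prod_unfold)
  ultimately have "?f summable_on ({(p, r). p < r} \<union> {(p, r). r < p})"
    by (rule summable_on_Un_disjoint) auto
  moreover have "{(p::nat, r). p < r} \<union> {(p, r). r < p} = {(p, r). p \<noteq> r}" by auto
  ultimately show ?thesis by simp
qed

section \<open>Comparison, finite partial fractions, antisymmetry and a harmonic telescope\<close>

lemma summable_on_inverse_comparison:
  fixes f :: "'a \<Rightarrow> 'b :: {real_normed_field, banach}" and g :: "'a \<Rightarrow> real"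
  assumes "(\<lambda>x. 1 / g x) summable_on A" "c > 0"
    and "\<And>x. x \<in> A \<Longrightarrow> 0 < g x" "\<And>x. x \<in> A \<Longrightarrow> c * g x \<le> norm (f x)"
  shows "(\<lambda>x. 1 / f x) summable_on A"
proof (rule abs_summable_summable, rule Infinite_Sum.abs_summable_on_comparison_test')
  show "(\<lambda>x. 1 / c * (1 / g x)) summable_on A"
    by (rule summable_on_cmult_right[OF assms(1)])
  fix x assume x: "x \<in> A"
  have "norm (1 / f x) = 1 / norm (f x)" by (simp add: norm_divide)
  also have "\<dots> \<le> 1 / (c * g x)"
    using assms(2) assms(3,4)[OF x] by (intro divide_left_mono) (auto intro!: mult_pos_pos
      intro: less_le_trans[of 0 "c * g x"])
  finally show "norm (1 / f x) \<le> 1 / c * (1 / g x)" by simp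
qed

text \<open>A geometric sum with ratio \<open>2 * x / (x + z)\<close>, whose distance from 1 is
  \<open>(z - x) / (x + z)\<close>. The last term on the right changes sign under exchange of
  \<open>x\<close> and \<open>z\<close>.\<close>

lemma sum_partial_fraction_power:
  fixes x z :: "'a :: field"
  assumes "x \<noteq> 0" "x + z \<noteq> 0" "x \<noteq> z"
  shows "(\<Sum>i<M. 2 ^ (i + 2) / (x ^ (M - i) * (x + z) ^ (i + 2)))
       = 4 / ((x + z) * (z - x) * x ^ M) - 4 * 2 ^ M / ((x + z) ^ (M + 1) * (z - x))"
proof (induction M)
  case (Suc M)
  have zx: "z - x \<noteq> 0" using assms by simp
  have "(\<Sum>i<M. 2 ^ (i + 2) / (x ^ (Suc M - i) * (x + z) ^ (i + 2)))
      = (\<Sum>i<M. 2 ^ (i + 2) / (x ^ (M - i) * (x + z) ^ (i + 2))) / x"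
    unfolding sum_divide_distrib by (intro sum.cong) (auto simp: Suc_diff_le mult_ac)
  also have "\<dots> = 4 / ((x + z) * (z - x) * x ^ Suc M)
      - 4 * 2 ^ M / ((x + z) ^ (M + 1) * (z - x)) / x"
    unfolding Suc.IH by (simp add: diff_divide_distrib mult_ac)
  finally have "(\<Sum>i<Suc M. 2 ^ (i + 2) / (x ^ (Suc M - i) * (x + z) ^ (i + 2)))
      = 4 / ((x + z) * (z - x) * x ^ Suc M)
        - (4 * 2 ^ M / ((x + z) ^ (M + 1) * (z - x)) / x - 2 ^ (M + 2) / (x * (x + z) ^ (M + 2)))"
    by simp
  \<comment> \<open>The numerator is \<open>(x + z) - (z - x) = 2 * x\<close>, which cancels the
    stray \<open>x\<close> and doubles the power of 2.\<close>
  also have "4 * 2 ^ M / ((x + z) ^ (M + 1) * (z - x)) / x - 2 ^ (M + 2) / (x * (x + z) ^ (M + 2))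
      = 4 * 2 ^ M * ((x + z) - (z - x)) / (x * (x + z) ^ (M + 2) * (z - x))"
    using assms zx by (simp add: divide_simps) (simp add: algebra_simps)
  also have "\<dots> = 4 * 2 ^ Suc M / ((x + z) ^ (Suc M + 1) * (z - x))"
    using assms zx by (simp add: divide_simps)
  finally show ?case .
qed simp

lemma has_sum_sum_fun:
  fixes f :: "'i \<Rightarrow> 'a \<Rightarrow> 'b :: topological_comm_monoid_add"
  assumes "\<And>i. i \<in> I \<Longrightarrow> (f i has_sum s i) A"
  shows "((\<lambda>x. \<Sum>i\<in>I. f i x) has_sum (\<Sum>i\<in>I. s i)) A"
  using assms by (induction I rule: infinite_finite_induct) (auto intro: has_sum_add)

lemma complex_of_rat_eq_of_real: "complex_of_rat q = complex_of_real (of_rat q)"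
  by (cases q) (simp add: of_rat_rat)

text \<open>Reindexing by the swap and pulling out the sign hold for \<open>infsum\<close> of
  arbitrary families (value 0 if not summable), so the sum equals its own negative.\<close>

lemma infsum_antisymmetric_eq_0:
  fixes f :: "'a \<times> 'a \<Rightarrow> 'b :: {real_normed_vector}"
  assumes "\<And>p r. (p, r) \<in> A \<Longrightarrow> (r, p) \<in> A" "\<And>p r. (p, r) \<in> A \<Longrightarrow> f (r, p) = - f (p, r)"
  shows "infsum f A = 0"
proof -
  have "bij_betw prod.swap A A"
    by (rule bij_betwI[where g = prod.swap]) (auto intro: assms(1))
  hence "infsum f A = infsum (\<lambda>z. f (prod.swap z)) A"
    by (rule infsum_reindex_bij_betw[symmetric])
  also have "\<dots> = infsum (\<lambda>z. - f z) A"
    by (rule infsum_cong) (auto simp: assms(2))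
  also have "\<dots> = - infsum f A" by (simp add: infsum_uminus)
  finally have "infsum f A + infsum f A = 0" by (metis add.right_inverse)
  hence "2 *\<^sub>R infsum f A = 0" by (simp add: scaleR_2)
  thus ?thesis by simp
qed

text \<open>With harmonic numbers \<open>H\<close>, the punctured part is \<open>H m - H p\<close>
  and the other is \<open>H (2 * p + 1 + m) - H p\<close>. What survives is a window of fixed length
  \<open>2 * p + 1\<close> starting at \<open>1 / (m + 1)\<close>.\<close>

lemma punctured_harmonic_telescope:
  fixes p m :: nat
  shows "(\<Sum>r<m + Suc p. (if r = p then 0 else 1 / (of_nat r - of_nat p)) - 1 / of_nat (Suc (p + r)))
       = - (\<Sum>i<Suc (p + p). 1 / (of_nat (Suc m + i) :: 'a :: field_char_0))"
proof (induction m)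
  case 0
  let ?f = "\<lambda>i. 1 / (of_nat (Suc i) :: 'a)"
  have split: "(\<Sum>i<p + k. ?f i) = (\<Sum>i<p. ?f i) + (\<Sum>i<k. ?f (p + i))" for k
    by (induction k) (simp_all add: add_ac)
  \<comment> \<open>Reflecting \<open>r\<close> to \<open>p - Suc r\<close> turns the terms left of
    the pole into \<open>- H p\<close>.\<close>
  have "(\<Sum>r<p. 1 / (of_nat r - of_nat p :: 'a)) = (\<Sum>r<p. - ?f (p - Suc r))"
  proof (rule sum.cong)
    fix r assume "r \<in> {..<p}"
    hence "of_nat (Suc (p - Suc r)) = (of_nat p - of_nat r :: 'a)"
      by (subst of_nat_diff[symmetric]) auto
    thus "1 / (of_nat r - of_nat p :: 'a) = - ?f (p - Suc r)"
      by (metis minus_diff_eq minus_divide_right)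
  qed simp
  also have "\<dots> = - (\<Sum>r<p. ?f r)"
    by (simp only: sum_negf sum.nat_diff_reindex[of ?f])
  finally have "(\<Sum>r<p. 1 / (of_nat r - of_nat p :: 'a)) = - (\<Sum>r<p. ?f r)" .
  moreover have "(\<Sum>r<Suc p. if r = p then 0 else 1 / (of_nat r - of_nat p :: 'a))
      = (\<Sum>r<p. 1 / (of_nat r - of_nat p))"
    by (auto intro!: sum.cong)
  ultimately have "(\<Sum>r<Suc p. (if r = p then 0 else 1 / (of_nat r - of_nat p)) - ?f (p + r))
      = - (\<Sum>i<p + Suc p. ?f i)"
    unfolding split sum_subtractf by simp
  thus ?case by simp
next
  case (Suc m)
  let ?f = "\<lambda>i. 1 / (of_nat (Suc m + i) :: 'a)"
  \<comment> \<open>Moving the window one place to the right costs its first term and gains a new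
    last one, matching the summand added at \<open>r = m + Suc p\<close>.\<close>
  have "(\<Sum>i<Suc (Suc (p + p)). ?f i) = ?f 0 + (\<Sum>i<Suc (p + p). ?f (Suc i))"
    by (rule sum.lessThan_Suc_shift)
  hence "(\<Sum>i<Suc (p + p). ?f i) = ?f 0 + (\<Sum>i<Suc (p + p). ?f (Suc i)) - ?f (Suc (p + p))"
    by (simp only: sum.lessThan_Suc) (simp add: algebra_simps)
  moreover have "of_nat (m + Suc p) - of_nat p = (of_nat (Suc m) :: 'a)"
    by simp
  ultimately show ?case
    using Suc.IH by (simp add: add_ac del: of_nat_Suc sum.lessThan_Suc) (simp add: add_ac)
qed

lemma punctured_harmonic_sums:
  "(\<lambda>r. (if r = p then 0 else 1 / (of_nat r - of_nat p)) - 1 / of_nat (Suc (p + r))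
      :: 'a :: real_normed_field) sums 0"
  unfolding sums_def
\<comment> \<open>The offset starts the partial sums beyond the pole at \<open>r = p\<close>, where
  the telescoped form applies.\<close>
proof (rule LIMSEQ_offset[where k = "Suc p"])
  have "(\<lambda>m. 1 / (of_nat (Suc m + i) :: 'a)) \<longlonglongrightarrow> 0" for i
    using LIMSEQ_ignore_initial_segment[OF lim_1_over_n[where 'a = 'a], of "Suc i"]
    by (simp add: add_ac)
  hence "(\<lambda>m. - (\<Sum>i<Suc (p + p). 1 / (of_nat (Suc m + i) :: 'a))) \<longlonglongrightarrow> - (\<Sum>i<Suc (p + p). 0)"
    by (intro tendsto_minus tendsto_sum)
  thus "(\<lambda>m. \<Sum>r<m + Suc p. (if r = p then 0 else 1 / (of_nat r - of_nat p))
      - 1 / (of_nat (Suc (p + r)) :: 'a)) \<longlonglongrightarrow> 0"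
    unfolding punctured_harmonic_telescope by simp
qed

section \<open>Index changes for the zeta values and for \<open>D_mu\<close>\<close>

lemma zeta_mu_single:
  "zeta_mu \<mu> [k] [m] = (\<Sum>\<^sub>\<infinity>p. \<mu> / (of_nat p * \<mu> + of_rat m) ^ k)"
proof -
  have bij: "bij_betw (\<lambda>p. [p]) UNIV {ns :: nat list. length ns = length [k] \<and> sorted ns}"
    by (rule bij_betwI[where g = hd]) (auto simp: length_Suc_conv)
  show ?thesis
    unfolding zeta_mu_def by (subst infsum_reindex_bij_betw[OF bij, symmetric]) simp
qed

text \<open>The gap \<open>r\<close> replaces the larger index; for \<open>m' = 2 * m\<close> the
  second linear form then becomes symmetric in \<open>p\<close> and \<open>r\<close>.\<close>

lemma zeta_mu_pair:
  "zeta_mu \<mu> [j, k] [m, m'] = (\<Sum>\<^sub>\<infinity>(p, r)\<in>UNIV.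
     \<mu>\<^sup>2 / ((of_nat p * \<mu> + of_rat m) ^ j * (of_nat (p + r) * \<mu> + of_rat m') ^ k))"
proof -
  have bij: "bij_betw (\<lambda>(p, r). [p, p + r]) UNIV
      {ns :: nat list. length ns = length [j, k] \<and> sorted ns}"
    by (rule bij_betwI[where g = "\<lambda>ns. (ns ! 0, ns ! 1 - ns ! 0)"]) (auto simp: length_Suc_conv)
  show ?thesis
    unfolding zeta_mu_def by (subst infsum_reindex_bij_betw[OF bij, symmetric])
      (auto intro!: infsum_cong simp: lessThan_Suc power2_eq_square mult_ac)
qed

lemma D_mu_eq_infsum_shift:
  "D_mu \<mu> K a b c = (c - b) * (\<Sum>\<^sub>\<infinity>(p, i)\<in>UNIV.
     \<mu>\<^sup>2 / ((of_nat p * \<mu> + a) ^ K * (of_nat (p + i) * \<mu> + b) * (of_nat (p + i) * \<mu> + c)))"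
proof -
  have bij: "bij_betw (\<lambda>(p, i). (p, p + i)) UNIV {(q1 :: nat, q2). q1 \<le> q2}"
    by (rule bij_betwI[where g = "\<lambda>(p, q). (p, q - p)"]) auto
  show ?thesis
    unfolding D_mu_def by (subst infsum_reindex_bij_betw[OF bij, symmetric])
      (auto intro!: infsum_cong)
qed

section \<open>Linear forms along a progression in the right half-plane\<close>

locale half_plane_progression =
  fixes \<mu> a :: complex
  assumes Re_mu: "Re \<mu> > 0" and Re_a: "Re a > 0"
begin

definition X :: "nat \<Rightarrow> complex" where "X p = of_nat p * \<mu> + a"

lemma X_add: "X p + X r = of_nat (p + r) * \<mu> + 2 * a"
  by (simp add: X_def algebra_simps)

lemma X_diff: "X r - X p = (of_nat r - of_nat p) * \<mu>"
  by (simp add: X_def algebra_simps)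

lemma mu_nonzero: "\<mu> \<noteq> 0"
  using Re_mu by auto

lemma X_eq_iff: "X p = X r \<longleftrightarrow> p = r"
  using mu_nonzero by (simp add: X_def)

lemma Re_X_pos: "Re (X p) > 0"
  using Re_mu Re_a by (auto simp: X_def intro!: add_nonneg_pos mult_nonneg_nonneg)

lemma X_nonzero: "X p \<noteq> 0"
  using Re_X_pos[of p] by auto

lemma X_add_nonzero: "X p + X r \<noteq> 0"
  using Re_X_pos[of p] Re_X_pos[of r] by (metis add_pos_pos less_irrefl plus_complex.sel(1) zero_complex.sel(1))

text \<open>One scale for all lower bounds: \<open>X p\<close>, \<open>X p + X r\<close> and
  \<open>X r - X p\<close> are at least \<open>lb\<close> times their integer counterparts in
  norm.\<close>

definition lb :: real where "lb = min (Re \<mu>) (Re a)"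

lemma lb_pos: "lb > 0"
  using Re_mu Re_a by (simp add: lb_def)

lemma norm_mu_ge: "lb \<le> norm \<mu>"
  using complex_Re_le_cmod[of \<mu>] by (simp add: lb_def)

lemma norm_X_ge: "lb * real (Suc p) \<le> norm (X p)"
proof -
  have "lb * real p + lb \<le> real p * Re \<mu> + Re a"
    by (intro add_mono) (auto simp: lb_def mult.commute[of _ "real p"] intro!: mult_left_mono)
  also have "\<dots> = Re (X p)" by (simp add: X_def)
  finally show ?thesis using complex_Re_le_cmod[of "X p"] by (simp add: algebra_simps)
qed

lemma norm_X_add_ge: "lb * real (Suc (p + r)) \<le> norm (X p + X r)"
proof -
  have "lb * real (p + r) + lb \<le> real (p + r) * Re \<mu> + Re a"
    by (intro add_mono) (auto simp: lb_def mult.commute[of _ "real p + real r"] intro!: mult_left_mono)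
  \<comment> \<open>The real part contains \<open>Re a\<close> twice; one copy is dropped.\<close>
  also have "\<dots> \<le> Re (X p + X r)" using Re_a by (simp add: X_def algebra_simps)
  finally show ?thesis using complex_Re_le_cmod[of "X p + X r"] by (simp add: algebra_simps)
qed

lemma norm_X_diff_ge: "lb * \<bar>real r - real p\<bar> \<le> norm (X r - X p)"
proof -
  have "norm (of_nat r - of_nat p :: complex) = \<bar>real r - real p\<bar>"
    by (metis norm_of_real of_real_diff of_real_of_nat_eq)
  thus ?thesis using norm_mu_ge
    by (simp add: X_diff norm_mult mult.commute mult_right_mono)
qed

text \<open>Lowering the exponent of \<open>Suc p\<close> to 1 lets one real majorant serve every
  weight.\<close>

lemma norm_X_power_ge:
  assumes "j \<ge> 1"
  shows "lb ^ j * real (Suc p) \<le> norm (X p ^ j)"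
proof -
  have "real (Suc p) ^ 1 \<le> real (Suc p) ^ j"
    using assms by (intro power_increasing) auto
  hence "lb ^ j * real (Suc p) \<le> (lb * real (Suc p)) ^ j"
    using lb_pos by (simp add: power_mult_distrib mult_left_mono del: of_nat_Suc)
  also have "\<dots> \<le> norm (X p) ^ j"
    using lb_pos by (intro power_mono norm_X_ge) auto
  finally show ?thesis by (simp add: norm_power)
qed

lemma norm_X_add_power_ge:
  assumes "k \<ge> 2"
  shows "lb ^ k * real (Suc (p + r)) ^ 2 \<le> norm ((X p + X r) ^ k)"
proof -
  have "real (Suc (p + r)) ^ 2 \<le> real (Suc (p + r)) ^ k"
    using assms by (intro power_increasing) auto
  hence "lb ^ k * real (Suc (p + r)) ^ 2 \<le> (lb * real (Suc (p + r))) ^ k"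
    using lb_pos by (simp add: power_mult_distrib mult_left_mono del: of_nat_Suc)
  also have "\<dots> \<le> norm (X p + X r) ^ k"
    using lb_pos by (intro power_mono norm_X_add_ge) auto
  finally show ?thesis by (simp add: norm_power)
qed

section \<open>Absolute summability of the complex kernels\<close>

lemma summable_zeta_pair:
  assumes "j \<ge> 1" "k \<ge> 2"
  shows "(\<lambda>(p, r). 1 / (X p ^ j * (X p + X r) ^ k)) summable_on UNIV"
  unfolding case_prod_unfold
proof (rule summable_on_inverse_comparison)
  show "(\<lambda>z. 1 / (real (Suc (fst z)) * real (Suc (fst z + snd z)) ^ 2)) summable_on UNIV"
    using summable_on_inverse_Suc_add_square by (simp add: case_prod_unfold)
  show "lb ^ j * lb ^ k > 0" using lb_pos by simp
  fix z :: "nat \<times> nat"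
  show "lb ^ j * lb ^ k * (real (Suc (fst z)) * real (Suc (fst z + snd z)) ^ 2)
      \<le> norm (X (fst z) ^ j * (X (fst z) + X (snd z)) ^ k)"
    using mult_mono[OF norm_X_power_ge[OF assms(1)] norm_X_add_power_ge[OF assms(2)]] lb_pos
    by (simp add: norm_mult mult_ac del: of_nat_Suc)
qed auto

text \<open>This is the kernel of \<open>D_mu\<close> at \<open>b = \<mu>\<close>,
  \<open>c = 2 * a\<close>. Both linear forms in \<open>p + i\<close> grow like
  \<open>Suc (p + i)\<close>, so the majorant of the zeta pairs works again.\<close>

lemma summable_D_kernel:
  assumes "K \<ge> 1"
  shows "(\<lambda>(p, i). 1 / (X p ^ K * (of_nat (Suc (p + i)) * \<mu>) * (X p + X i))) summable_on UNIV"
  unfolding case_prod_unfold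
proof (rule summable_on_inverse_comparison)
  show "(\<lambda>z. 1 / (real (Suc (fst z)) * real (Suc (fst z + snd z)) ^ 2)) summable_on UNIV"
    using summable_on_inverse_Suc_add_square by (simp add: case_prod_unfold)
  show "lb ^ K * lb * lb > 0" using lb_pos by simp
  fix z :: "nat \<times> nat"
  obtain p i where z: "z = (p, i)" by (cases z)
  have "norm (of_nat (Suc (p + i)) * \<mu>) = real (Suc (p + i)) * norm \<mu>"
    by (simp only: norm_mult norm_of_nat)
  hence "lb * real (Suc (p + i)) \<le> norm (of_nat (Suc (p + i)) * \<mu>)"
    using norm_mu_ge by (simp add: mult.commute mult_right_mono del: of_nat_Suc)
  hence "lb ^ K * real (Suc p) * (lb * real (Suc (p + i)))
      \<le> norm (X p ^ K) * norm (of_nat (Suc (p + i)) * \<mu>)"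
    using lb_pos norm_X_power_ge[OF assms, of p]
    by (intro mult_mono) (auto simp del: of_nat_Suc)
  hence "lb ^ K * real (Suc p) * (lb * real (Suc (p + i))) * (lb * real (Suc (p + i)))
      \<le> norm (X p ^ K) * norm (of_nat (Suc (p + i)) * \<mu>) * norm (X p + X i)"
    by (rule mult_mono[OF _ norm_X_add_ge]) (use lb_pos in auto)
  thus "lb ^ K * lb * lb * (real (Suc (fst z)) * real (Suc (fst z + snd z)) ^ 2)
      \<le> norm (X (fst z) ^ K * (of_nat (Suc (fst z + snd z)) * \<mu>) * (X (fst z) + X (snd z)))"
    by (simp only: z fst_conv snd_conv norm_mult power2_eq_square mult_ac)
qed auto

lemma summable_off_diagonal:
  assumes "M \<ge> 1"
  shows "(\<lambda>(p, r). 1 / ((X p + X r) * (X r - X p) * X p ^ M)) summable_on {(p, r). p \<noteq> r}"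
  unfolding case_prod_unfold
proof (rule summable_on_inverse_comparison)
  show "(\<lambda>z. 1 / (real (Suc (fst z)) * real (Suc (fst z + snd z)) * \<bar>real (snd z) - real (fst z)\<bar>))
      summable_on {z. fst z \<noteq> snd z}"
    using summable_on_inverse_Suc_add_diff by (simp add: case_prod_unfold)
  show "lb ^ M * lb * lb > 0" using lb_pos by simp
  fix z :: "nat \<times> nat"
  obtain p r where z: "z = (p, r)" by (cases z)
  have "lb ^ M * real (Suc p) * (lb * real (Suc (p + r))) * (lb * \<bar>real r - real p\<bar>)
      \<le> norm (X p ^ M) * norm (X p + X r) * norm (X r - X p)"
    using lb_pos by (intro mult_mono norm_X_power_ge[OF assms] norm_X_add_ge norm_X_diff_ge) auto
  thus "lb ^ M * lb * lb * (real (Suc (fst z)) * real (Suc (fst z + snd z)) * \<bar>real (snd z) - real (fst z)\<bar>)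
      \<le> norm ((X (fst z) + X (snd z)) * (X (snd z) - X (fst z)) * X (fst z) ^ M)"
    by (simp only: z fst_conv snd_conv norm_mult mult_ac)
qed auto

section \<open>Partial fractions and summation along rows\<close>

lemma D_partial_fraction:
  "(2 * a - \<mu>) / ((of_nat (Suc (p + i)) * \<mu>) * (X p + X i))
     = 1 / (of_nat (Suc (p + i)) * \<mu>) - 1 / (X p + X i)"
proof -
  \<comment> \<open>The prefactor \<open>c - b\<close> of \<open>D_mu\<close> is the difference of
    its two linear forms.\<close>
  have "2 * a - \<mu> = (X p + X i) - of_nat (Suc (p + i)) * \<mu>"
    by (simp add: X_add algebra_simps)
  moreover have "of_nat (Suc (p + i)) * \<mu> \<noteq> 0"
    using mu_nonzero by (simp del: of_nat_Suc)
  ultimately show ?thesis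
    using X_add_nonzero[of p i] by (simp only: diff_divide_distrib) simp
qed

text \<open>The two linear forms differ by \<open>2 * X p\<close>, which is constant in
  \<open>r\<close>, so \<open>r\<close> survives only in simple fractions.\<close>

lemma off_diagonal_partial_fraction:
  assumes "r \<noteq> p"
  shows "1 / ((X p + X r) * (X r - X p) * X p ^ M)
       = 1 / (2 * X p ^ (M + 1)) * (1 / (X r - X p) - 1 / (X p + X r))"
proof -
  have "X r - X p \<noteq> 0" using assms X_eq_iff by auto
  hence "1 / (X r - X p) - 1 / (X p + X r) = 2 * X p / ((X p + X r) * (X r - X p))"
    using X_add_nonzero[of p r] by (simp add: field_simps)
  thus ?thesis using X_nonzero[of p] by simp
qed

text \<open>In terms of the digamma function \<psi>, this is
  \<open>(\<psi> (p + 2 * a / \<mu>) - \<psi> (p + 1)) / \<mu>\<close>.\<close>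

definition T :: "nat \<Rightarrow> complex" where
  "T p = (\<Sum>\<^sub>\<infinity>i. 1 / (of_nat (Suc (p + i)) * \<mu>) - 1 / (X p + X i))"

lemma T_has_sum:
  "((\<lambda>i. 1 / (of_nat (Suc (p + i)) * \<mu>) - 1 / (X p + X i)) has_sum T p) UNIV"
proof -
  \<comment> \<open>A row of a summable double family is summable; the factor \<open>X p\<close>,
    constant along the row, is multiplied back afterwards.\<close>
  have "(\<lambda>(p, i). 1 / (X p ^ 1 * (of_nat (Suc (p + i)) * \<mu>) * (X p + X i)))
      summable_on (SIGMA p:UNIV. UNIV)"
    using summable_D_kernel[of 1] by simp
  from summable_on_SigmaD1[OF this, of p]
  have "(\<lambda>i. 1 / (X p ^ 1 * (of_nat (Suc (p + i)) * \<mu>) * (X p + X i))) summable_on UNIV" by simp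
  hence "(\<lambda>i. (2 * a - \<mu>) * X p * (1 / (X p ^ 1 * (of_nat (Suc (p + i)) * \<mu>) * (X p + X i))))
      summable_on UNIV"
    by (rule summable_on_cmult_right)
  also have "(\<lambda>i. (2 * a - \<mu>) * X p * (1 / (X p ^ 1 * (of_nat (Suc (p + i)) * \<mu>) * (X p + X i))))
      = (\<lambda>i. (2 * a - \<mu>) / ((of_nat (Suc (p + i)) * \<mu>) * (X p + X i)))"
    using X_nonzero[of p] by (auto simp: fun_eq_iff mult.assoc simp del: of_nat_Suc)
  finally show ?thesis
    unfolding T_def D_partial_fraction by (rule has_sum_infsum)
qed

text \<open>
  The poles of the two series over \<open>r\<close> are distributed differently (\<open>1 / (r - p)\<close> against
  \<open>1 / (p + r + 1)\<close>), but their difference telescopes to \<open>0\<close>; the extra \<open>1 / (2 * X p)\<close> is the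
  omitted term at \<open>r = p\<close>.
\<close>
lemma punctured_has_sum:
  "((\<lambda>r. 1 / (X r - X p) - 1 / (X p + X r)) has_sum (1 / (2 * X p) + T p)) (- {p})"
proof -
  \<comment> \<open>The summand is extended to \<open>r = p\<close> with the pole replaced by 0, so
    that \<open>t p = - (1 / (2 * X p))\<close>.\<close>
  define t where "t r = (if r = p then 0 else 1 / (X r - X p)) - 1 / (X p + X r)" for r
  have "{(p::nat, r). p \<noteq> r} = (SIGMA p:UNIV. - {p})" by auto
  hence "(\<lambda>(p, r). 1 / ((X p + X r) * (X r - X p) * X p ^ 1)) summable_on (SIGMA p:UNIV. - {p})"
    using summable_off_diagonal[of 1] by simp
  from summable_on_SigmaD1[OF this, of p]
  have "(\<lambda>r. 1 / ((X p + X r) * (X r - X p) * X p ^ 1)) summable_on (- {p})" by simp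
  hence "(\<lambda>r. 2 * X p ^ 2 * (1 / ((X p + X r) * (X r - X p) * X p ^ 1))) summable_on (- {p})"
    by (rule summable_on_cmult_right)
  also have "?this \<longleftrightarrow> t summable_on (- {p})"
    by (rule summable_on_cong, subst off_diagonal_partial_fraction)
       (use X_nonzero in \<open>auto simp: t_def power2_eq_square\<close>)
  finally obtain S where S: "(t has_sum S) (- {p})" by (auto simp: summable_on_def)
  have "(t has_sum t p) {p}" by (rule has_sum_finiteI) auto
  from has_sum_Un_disjoint[OF S this] have "(t has_sum (S + t p)) (- {p} \<union> {p})"
    by simp
  also have "- {p} \<union> {p} = UNIV" by auto
  finally have "(t has_sum (S + t p)) UNIV" .
  \<comment> \<open>Ordered sums take over here, because the harmonic telescope is a limit of
    partial sums. The terms \<open>1 / (X p + X r)\<close> cancel in the difference.\<close>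
  from has_sum_imp_sums[OF this] has_sum_imp_sums[OF T_has_sum[of p]]
  have "(\<lambda>r. t r - (1 / (of_nat (Suc (p + r)) * \<mu>) - 1 / (X p + X r))) sums (S + t p - T p)"
    by (rule sums_diff)
  moreover have "(\<lambda>r. t r - (1 / (of_nat (Suc (p + r)) * \<mu>) - 1 / (X p + X r)))
      = (\<lambda>r. ((if r = p then 0 else 1 / (of_nat r - of_nat p)) - 1 / of_nat (Suc (p + r))) / \<mu>)"
    by (auto simp: t_def fun_eq_iff X_diff diff_divide_distrib simp del: of_nat_Suc)
  moreover have "\<dots> sums (0 / \<mu>)"
    by (intro sums_divide punctured_harmonic_sums)
  ultimately have "S + t p - T p = 0" using sums_unique2 by fastforce
  moreover have "t p = - (1 / (2 * X p))" by (simp add: t_def)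
  ultimately have "S = 1 / (2 * X p) + T p" by (simp add: algebra_simps)
  moreover have "(t has_sum S) (- {p})
      \<longleftrightarrow> ((\<lambda>r. 1 / (X r - X p) - 1 / (X p + X r)) has_sum S) (- {p})"
    by (rule has_sum_cong) (auto simp: t_def)
  ultimately show ?thesis using S by simp
qed

text \<open>Restrict the pair kernel to its diagonal, where \<open>X p + X p\<close> is twice
  \<open>X p\<close>.\<close>

lemma summable_inverse_X_power:
  assumes "M \<ge> 1"
  shows "(\<lambda>p. 1 / X p ^ (M + 2)) summable_on UNIV"
proof -
  have "(\<lambda>(p, r). 1 / (X p ^ M * (X p + X r) ^ 2)) summable_on range (\<lambda>p. (p, p))"
    using summable_zeta_pair[of M 2] assms by (rule_tac summable_on_subset_banach) auto
  hence "(\<lambda>p. 1 / (X p ^ M * (X p + X p) ^ 2)) summable_on UNIV"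
    by (subst (asm) summable_on_reindex) (auto simp: inj_on_def o_def)
  hence "(\<lambda>p. 4 * (1 / (X p ^ M * (X p + X p) ^ 2))) summable_on UNIV"
    by (rule summable_on_cmult_right)
  thus ?thesis by (simp add: power_mult_distrib power2_eq_square mult_ac flip: mult_2)
qed

text \<open>Summing the kernel of \<open>D_mu\<close> row by row: each row is a constant multiple of
  the series for \<open>T p\<close>.\<close>

lemma T_weighted_has_sum:
  assumes "K \<ge> 1"
  shows "((\<lambda>p. 1 / X p ^ K * T p) has_sum
     (2 * a - \<mu>) * (\<Sum>\<^sub>\<infinity>(p, i)\<in>UNIV.
        1 / (X p ^ K * (of_nat (Suc (p + i)) * \<mu>) * (X p + X i)))) UNIV"
proof (rule has_sum_SigmaD)
  let ?f = "\<lambda>(p, i). 1 / (X p ^ K * (of_nat (Suc (p + i)) * \<mu>) * (X p + X i))"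
  show "((\<lambda>z. (2 * a - \<mu>) * ?f z) has_sum (2 * a - \<mu>) * infsum ?f UNIV) (SIGMA p:UNIV. UNIV)"
    using has_sum_cmult_right[OF has_sum_infsum[OF summable_D_kernel[OF assms]]] by simp
  show "((\<lambda>i. (2 * a - \<mu>) * ?f (p, i)) has_sum 1 / X p ^ K * T p) UNIV" for p
    using has_sum_cmult_right[OF T_has_sum[of p], of "1 / X p ^ K"]
    by (simp add: D_partial_fraction[symmetric] mult.assoc del: of_nat_Suc)
qed

text \<open>Row \<open>p\<close> sums to \<open>1 / (2 * X p) + T p\<close> with weight
  \<open>1 / (2 * X p ^ (M + 1))\<close>; the two summands yield the coefficients 1/4 and
  1/2.\<close>

lemma infsum_off_diagonal:
  assumes "M \<ge> 1"
  shows "(\<Sum>\<^sub>\<infinity>(p, r)\<in>{(p, r). p \<noteq> r}. 1 / ((X p + X r) * (X r - X p) * X p ^ M))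
       = 1 / 4 * (\<Sum>\<^sub>\<infinity>p. 1 / X p ^ (M + 2)) + 1 / 2 * ((2 * a - \<mu>) * (\<Sum>\<^sub>\<infinity>(p, i)\<in>UNIV.
        1 / (X p ^ (M + 1) * (of_nat (Suc (p + i)) * \<mu>) * (X p + X i))))"
    (is "infsum ?h ?A = ?R")
proof -
  have A: "?A = (SIGMA p:UNIV. - {p})" by auto
  have "(?h has_sum infsum ?h ?A) (SIGMA p:UNIV. - {p})"
    unfolding A[symmetric] by (intro has_sum_infsum summable_off_diagonal assms)
  hence "((\<lambda>p. 1 / (2 * X p ^ (M + 1)) * (1 / (2 * X p) + T p)) has_sum infsum ?h ?A) UNIV"
  proof (rule has_sum_SigmaD)
    fix p
    have "((\<lambda>r. 1 / (2 * X p ^ (M + 1)) * (1 / (X r - X p) - 1 / (X p + X r))) has_sum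
        1 / (2 * X p ^ (M + 1)) * (1 / (2 * X p) + T p)) (- {p})"
      by (rule has_sum_cmult_right[OF punctured_has_sum])
    also have "?this \<longleftrightarrow> ((\<lambda>r. ?h (p, r)) has_sum
        1 / (2 * X p ^ (M + 1)) * (1 / (2 * X p) + T p)) (- {p})"
      by (rule has_sum_cong) (simp add: off_diagonal_partial_fraction)
    finally show "((\<lambda>r. ?h (p, r)) has_sum
        1 / (2 * X p ^ (M + 1)) * (1 / (2 * X p) + T p)) (- {p})" .
  qed
  moreover have "((\<lambda>p. 1 / 4 * (1 / X p ^ (M + 2)) + 1 / 2 * (1 / X p ^ (M + 1) * T p)) has_sum ?R) UNIV"
    using assms by (intro has_sum_add has_sum_cmult_right has_sum_infsum summable_inverse_X_power
        T_weighted_has_sum) auto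
  moreover have "1 / (2 * X p ^ (M + 1)) * (1 / (2 * X p) + T p)
      = 1 / 4 * (1 / X p ^ (M + 2)) + 1 / 2 * (1 / X p ^ (M + 1) * T p)" for p
    by (simp add: distrib_left add_divide_distrib mult_ac)
  ultimately show ?thesis using has_sum_unique by simp
qed

text \<open>The coefficient \<open>M + 1\<close> collects \<open>M\<close> from the diagonal and 4
  times 1/4 from off the diagonal; the final 2 is 4 times 1/2.\<close>

lemma infsum_sum_formula:
  assumes "M \<ge> 1"
  shows "(\<Sum>i<M. 2 ^ (i + 2) * (\<Sum>\<^sub>\<infinity>(p, r)\<in>UNIV. 1 / (X p ^ (M - i) * (X p + X r) ^ (i + 2))))
       = of_nat (M + 1) * (\<Sum>\<^sub>\<infinity>p. 1 / X p ^ (M + 2)) + 2 * ((2 * a - \<mu>) * (\<Sum>\<^sub>\<infinity>(p, i)\<in>UNIV.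
        1 / (X p ^ (M + 1) * (of_nat (Suc (p + i)) * \<mu>) * (X p + X i))))"
proof -
  let ?A = "{(p::nat, r). p \<noteq> r}" and ?B = "range (\<lambda>p::nat. (p, p))"
  define F where "F = (\<lambda>(p, r). \<Sum>i<M. 2 ^ (i + 2) / (X p ^ (M - i) * (X p + X r) ^ (i + 2)))"
  define h where "h = (\<lambda>(p, r). 4 * (1 / ((X p + X r) * (X r - X p) * X p ^ M)))"
  define e where "e = (\<lambda>(p, r). 4 * 2 ^ M / ((X p + X r) ^ (M + 1) * (X r - X p)))"
  have "((\<lambda>z. \<Sum>i<M. 2 ^ (i + 2) * (case z of (p, r) \<Rightarrow> 1 / (X p ^ (M - i) * (X p + X r) ^ (i + 2))))
      has_sum (\<Sum>i<M. 2 ^ (i + 2) *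
        (\<Sum>\<^sub>\<infinity>(p, r)\<in>UNIV. 1 / (X p ^ (M - i) * (X p + X r) ^ (i + 2))))) UNIV"
    by (intro has_sum_sum_fun has_sum_cmult_right has_sum_infsum summable_zeta_pair) auto
  hence F: "(F has_sum (\<Sum>i<M. 2 ^ (i + 2) *
      (\<Sum>\<^sub>\<infinity>(p, r)\<in>UNIV. 1 / (X p ^ (M - i) * (X p + X r) ^ (i + 2))))) UNIV"
    by (simp add: F_def case_prod_unfold)
  have summable: "F summable_on Z" for Z
    using has_sum_imp_summable[OF F] by (rule summable_on_subset_banach) auto
  have "infsum F UNIV = infsum F (?B \<union> ?A)"
    by (rule arg_cong[where f = "infsum F"]) auto
  also have "\<dots> = infsum F ?B + infsum F ?A"
    by (intro infsum_Un_disjoint summable) auto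
  also have "infsum F ?B = (\<Sum>\<^sub>\<infinity>p. F (p, p))"
    by (subst infsum_reindex) (auto simp: inj_on_def o_def)
  also have "\<dots> = (\<Sum>\<^sub>\<infinity>p. of_nat M * (1 / X p ^ (M + 2)))"
  proof (rule infsum_cong)
    fix p
    \<comment> \<open>The weights \<open>2 ^ k\<close> are exactly what makes all diagonal terms
      equal.\<close>
    have "2 ^ (i + 2) / (X p ^ (M - i) * (X p + X p) ^ (i + 2)) = 1 / X p ^ (M + 2)" if "i < M" for i
    proof -
      have "X p ^ (M - i) * X p ^ (i + 2) = X p ^ (M + 2)"
        using that by (subst power_add[symmetric]) simp
      moreover have "(X p + X p) ^ (i + 2) = 2 ^ (i + 2) * X p ^ (i + 2)"
        by (simp only: mult_2[symmetric] power_mult_distrib)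
      ultimately show ?thesis by (simp add: mult.left_commute)
    qed
    hence "F (p, p) = (\<Sum>i<M. 1 / X p ^ (M + 2))"
      unfolding F_def prod.case by (intro sum.cong) (simp_all only: lessThan_iff)
    thus "F (p, p) = of_nat M * (1 / X p ^ (M + 2))" by (simp only: sum_constant card_lessThan)
  qed
  also have "\<dots> = of_nat M * (\<Sum>\<^sub>\<infinity>p. 1 / X p ^ (M + 2))"
    by (rule infsum_cmult_right')
  also have "infsum F ?A = infsum h ?A"
  proof -
    have h: "h summable_on ?A"
      using summable_on_cmult_right[OF summable_off_diagonal[OF assms], of 4]
      by (simp add: h_def case_prod_unfold)
    have F_eq: "F z = h z - e z" if "z \<in> ?A" for z
      using that sum_partial_fraction_power[OF X_nonzero X_add_nonzero, where M = M]
      by (auto simp: F_def h_def e_def X_eq_iff)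
    \<comment> \<open>Both \<open>h\<close> and \<open>F\<close> are summable off the diagonal, so
      their sums may be subtracted termwise, leaving the antisymmetric \<open>e\<close>.\<close>
    have "infsum h ?A - infsum F ?A = infsum (\<lambda>z. h z - F z) ?A"
      using infsum_add[OF h iffD2[OF summable_on_uminus summable]] by (simp add: infsum_uminus)
    also have "\<dots> = infsum e ?A"
      by (rule infsum_cong) (simp add: F_eq)
    also have "\<dots> = 0"
    proof (rule infsum_antisymmetric_eq_0)
      fix p r
      have "(X r + X p) ^ (M + 1) * (X p - X r) = - ((X p + X r) ^ (M + 1) * (X r - X p))"
        by (simp add: add.commute right_diff_distrib)
      thus "e (r, p) = - e (p, r)" unfolding e_def by (simp only: prod.case divide_minus_right)
    qed auto
    finally show ?thesis by simp
  qed
  also have "infsum h ?A = 4 * (\<Sum>\<^sub>\<infinity>(p, r)\<in>?A. 1 / ((X p + X r) * (X r - X p) * X p ^ M))"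
    by (subst infsum_cmult_right'[symmetric]) (simp add: h_def case_prod_unfold)
  also note infsum_off_diagonal[OF assms]
  finally show ?thesis using infsumI[OF F] by (simp add: algebra_simps)
qed

end

section \<open>Specialization to rational parameters\<close>

theorem theorem5p7:
  fixes \<mu> :: complex and n :: rat and N :: nat
  assumes "Re \<mu> > 0" and "n > 0" and "N \<ge> 3"
  shows "(\<Sum>(j, k)\<in>{(j :: nat, k :: nat). j + k = N \<and> j \<ge> 1 \<and> k \<ge> 2}.
            2 ^ k * zeta_mu \<mu> [j, k] [n, 2 * n])
         = \<mu> * of_nat (N - 1) * zeta_mu \<mu> [N] [n]
           + 2 * D_mu \<mu> (N - 1) (of_rat n) \<mu> (2 * of_rat n)"
proof -
  define M where "M = N - 2"
  have M: "M \<ge> 1" "N = M + 2" using assms by (auto simp: M_def)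
  have "Re (of_rat n) > 0"
    using assms(2) by (simp add: complex_of_rat_eq_of_real)
  then interpret half_plane_progression \<mu> "of_rat n"
    using assms(1) by unfold_locales
  \<comment> \<open>A single index carries one factor \<mu>, while the pair sums and
    \<open>D_mu\<close> carry two; this accounts for the extra \<mu> in front of
    \<open>zeta_mu \<mu> [N] [n]\<close>.\<close>
  have zeta1: "zeta_mu \<mu> [N] [n] = \<mu> * (\<Sum>\<^sub>\<infinity>p. 1 / X p ^ (M + 2))"
    by (simp add: zeta_mu_single M X_def flip: infsum_cmult_right')
  have zeta2: "zeta_mu \<mu> [j, k] [n, 2 * n]
      = \<mu>\<^sup>2 * (\<Sum>\<^sub>\<infinity>(p, r)\<in>UNIV. 1 / (X p ^ j * (X p + X r) ^ k))" for j k
    by (simp add: zeta_mu_pair X_add of_rat_mult case_prod_unfold flip: infsum_cmult_right')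
       (simp add: X_def)
  have D: "D_mu \<mu> (N - 1) (of_rat n) \<mu> (2 * of_rat n) = \<mu>\<^sup>2 * ((2 * of_rat n - \<mu>) *
      (\<Sum>\<^sub>\<infinity>(p, i)\<in>UNIV. 1 / (X p ^ (M + 1) * (of_nat (Suc (p + i)) * \<mu>) * (X p + X i))))"
    unfolding D_mu_eq_infsum_shift mult.left_commute[of "\<mu>\<^sup>2"] infsum_cmult_right'[symmetric]
    by (simp add: X_add M case_prod_unfold) (simp add: X_def algebra_simps)
  have "(\<Sum>(j, k)\<in>{(j, k). j + k = N \<and> j \<ge> 1 \<and> k \<ge> 2}. 2 ^ k * zeta_mu \<mu> [j, k] [n, 2 * n])
      = (\<Sum>i<M. 2 ^ (i + 2) * zeta_mu \<mu> [M - i, i + 2] [n, 2 * n])"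
    \<comment> \<open>The index \<open>i = k - 2\<close> runs below \<open>M = N - 2\<close>, since
      \<open>j \<ge> 1\<close> forces \<open>k \<le> N - 1\<close>.\<close>
    by (rule sum.reindex_bij_witness[where i = "\<lambda>i. (M - i, i + 2)" and j = "\<lambda>(j, k). k - 2"])
       (auto simp: M simp del: power_Suc add_2_eq_Suc add_2_eq_Suc', metis add_diff_cancel_right')
  also have "\<dots> = \<mu>\<^sup>2 * (\<Sum>i<M. 2 ^ (i + 2) *
      (\<Sum>\<^sub>\<infinity>(p, r)\<in>UNIV. 1 / (X p ^ (M - i) * (X p + X r) ^ (i + 2))))"
    unfolding zeta2 sum_distrib_left by (simp only: mult.left_commute)
  also note infsum_sum_formula[OF M(1)]
  finally show ?thesis unfolding zeta1 D by (simp add: M(2) power2_eq_square algebra_simps)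
qed

end
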